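(* Let $u$ solve $\mathrm{i}\,\partial_t u=\mathcal{G}(u)u$ on the time step $[t_n,t_{n+1}]$, $h=t_{n+1}-t_n$, and let $u^{[k]}$, $k\ge0$, be the iterates on $[t_n,t_{n+1}]$ given by $u^{[0]}(t)\equiv u(t_n)$ and $$\mathrm{i}\,\partial_t u^{[k+1]}(t)=\mathcal{G}(u^{[k]}(t))\,u^{[k+1]}(t),\qquad u^{[k+1]}(t_n)=u(t_n).$$ Set $\rho_k(t)=\|u^{[k]}(\cdot,t)-u(\cdot,t)\|_{L_2(\mathbb{T}^d)}$, and let $c_1>0$ and $p_1$ (the order of the first iterate) be such that $\rho_1(t)\le c_1h^{p_1+1}$ for $t\in[t_n,t_{n+1}]$. If $\mathcal{G}$ is Fréchet differentiable, with constant $\mathcal{G}'(u)$ as described in the context, then $$\rho_k(t)\le\bigl[\mathcal{G}'(u)\,\|u\|_{L_2}\bigr]^{k-1}c_1\,h^{p_1+k},\qquad k\in\mathbb{N}=\{1,2,\dots\},\ t\in[t_n,t_{n+1}],$$ and the iteration converges, i.e. $\rho_k(t)\to0$ as $k\to\infty$, for $h<\bigl[\mathcal{G}'(u)\,\|u\|_{L_2}\bigr]^{-1}$.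
   Context: The spatial domain is the torus $\mathbb{T}^d$ with the standard $L_2(\mathbb{T}^d)$ inner product $\langle\cdot,\cdot\rangle$. The dispersive equation is $\mathrm{i}\,\partial_t u=\mathcal{G}(u)u$ with $u(0)=u_0\in H^s(\mathbb{T}^d)$ for some $s\in\mathbb{N}$. For each $v$, $\mathcal{G}(v)$ is a (possibly unbounded) linear self-adjoint operator acting weakly on $H^s(\mathbb{T}^d)$, of the form $\mathcal{G}(v)=\mathcal{L}+f(v)$ with $\mathcal{L}$ linear self-adjoint and $f(v)=g(v,\overline v)$ a real-valued function acting by multiplication; for example $\mathcal{G}(v)=-\Delta+\lambda|v|^2$. Hence $\operatorname{Im}\langle\mathcal{G}(v)w,w\rangle=0$ and the norm $\|u\|_{L_2}=\|u(\cdot,t)\|_{L_2}$ is constant in time. The exact solution and the iterates are assumed to exist on the step and to be as regular as required. Fréchet differentiability is used in the following sense: $\mathcal{G}'(v)\in(0,\infty)$ denotes a number for which $$\|\mathcal{G}(v+\delta)-\mathcal{G}(v)\|_{L_2}\le\mathcal{G}'(v)\,\|\delta\|_{L_2},\qquad v,\delta\in H^2(\mathbb{T}^d),\quad\|\delta\|_{L_2}\ll1,$$ where the norm on the left is the $L_2\to L_2$ operator norm. In the claim, $\mathcal{G}'(u)$ denotes such a number valid for $v=u(t)$ for all $t\in[t_n,t_{n+1}]$, and the errors $\delta=u^{[k]}(t)-u(t)$, $k\ge1$, $t\in[t_n,t_{n+1}]$, are assumed to lie in the range in which this inequality holds. The order of iterate $k$ is the number $p_k$ with $\rho_k(t)\le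 c_kh^{p_k+1}$ on $[t_n,t_{n+1}]$ for some $c_k>0$. *)

theory Defs
  imports "HOL-Analysis.Analysis"
begin

(* The torus is (R / 2 pi Z)^d, with the index type 'd of cardinality d. As a measure space it is
   the fundamental domain [0, 2 pi)^d with Lebesgue measure (unnormalised). *)

definition torus :: "(real ^ 'd) set"
  where "torus = {x. \<forall>i. 0 \<le> x $ i \<and> x $ i < 2 * pi}"

definition torus_measure :: "(real ^ 'd) measure"
  where "torus_measure = restrict_space lborel torus"

definition square_integrable :: "(real ^ 'd \<Rightarrow> complex) \<Rightarrow> bool"
  where "square_integrable f \<longleftrightarrow>
    f \<in> borel_measurable torus_measure \<and> integrable torus_measure (\<lambda>x. (cmod (f x))\<^sup>2)"

lemma square_integrable_0: "square_integrable (\<lambda>x. 0)"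
  by (simp add: square_integrable_def)

lemma square_integrable_scale:
  assumes "square_integrable f"
  shows "square_integrable (\<lambda>x. c * f x)"
  using assms by (auto simp: square_integrable_def norm_mult power_mult_distrib)

lemma square_integrable_cnj:
  assumes "square_integrable f"
  shows "square_integrable (\<lambda>x. cnj (f x))"
proof -
  have "cnj \<in> borel_measurable borel"
    by (intro borel_measurable_continuous_onI continuous_intros)
  then show ?thesis
    using assms by (auto simp: square_integrable_def intro: measurable_compose)
qed

lemma square_integrable_mult_cnj:
  assumes "square_integrable f" "square_integrable g"
  shows "integrable torus_measure (\<lambda>x. f x * cnj (g x))"
proof (rule Bochner_Integration.integrable_bound)
  show "integrable torus_measure (\<lambda>x. (cmod (f x))\<^sup>2 + (cmod (g x))\<^sup>2)"
    using assms by (auto simp: square_integrable_def)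
  show "(\<lambda>x. f x * cnj (g x)) \<in> borel_measurable torus_measure"
    using assms square_integrable_cnj[of g] by (auto simp: square_integrable_def)
  have "a * b \<le> a\<^sup>2 + b\<^sup>2" if "a \<ge> 0" "b \<ge> 0" for a b :: real
    using sum_squares_bound[of a b] that mult_nonneg_nonneg[of a b] by linarith
  then show "AE x in torus_measure.
      norm (f x * cnj (g x)) \<le> norm ((cmod (f x))\<^sup>2 + (cmod (g x))\<^sup>2)"
    by (auto simp: norm_mult)
qed

lemma square_integrable_add:
  assumes "square_integrable f" "square_integrable g"
  shows "square_integrable (\<lambda>x. f x + g x)"
proof -
  have meas: "(\<lambda>x. f x + g x) \<in> borel_measurable torus_measure"
    using assms by (auto simp: square_integrable_def)
  have "integrable torus_measure (\<lambda>x. (cmod (f x + g x))\<^sup>2)"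
  proof (rule Bochner_Integration.integrable_bound)
    show "integrable torus_measure (\<lambda>x. 2 * (cmod (f x))\<^sup>2 + 2 * (cmod (g x))\<^sup>2)"
      using assms by (auto simp: square_integrable_def)
    show "(\<lambda>x. (cmod (f x + g x))\<^sup>2) \<in> borel_measurable torus_measure"
      using meas by measurable
    have "(cmod (a + b))\<^sup>2 \<le> 2 * (cmod a)\<^sup>2 + 2 * (cmod b)\<^sup>2" for a b
    proof -
      have "(cmod (a + b))\<^sup>2 \<le> (cmod a + cmod b)\<^sup>2"
        by (intro power_mono norm_triangle_ineq) auto
      also have "\<dots> \<le> 2 * (cmod a)\<^sup>2 + 2 * (cmod b)\<^sup>2"
        using sum_squares_bound[of "cmod a" "cmod b"] by (simp add: power2_sum)
      finally show ?thesis .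
    qed
    then show "AE x in torus_measure. norm ((cmod (f x + g x))\<^sup>2)
        \<le> norm (2 * (cmod (f x))\<^sup>2 + 2 * (cmod (g x))\<^sup>2)"
      by auto
  qed
  with meas show ?thesis
    by (simp add: square_integrable_def)
qed

quotient_type (overloaded) 'd torus_L2 = "real ^ ('d::finite) \<Rightarrow> complex" / partial:
  "\<lambda>f g. square_integrable f \<and> square_integrable g \<and> (AE x in torus_measure. f x = g x)"
proof (rule part_equivpI)
  show "\<exists>f::real ^ 'd \<Rightarrow> complex. square_integrable f \<and> square_integrable f \<and>
      (AE x in torus_measure. f x = f x)"
    using square_integrable_0 by auto
qed (auto intro!: sympI transpI)

instantiation torus_L2 :: (finite) real_inner
begin

lift_definition zero_torus_L2 :: "'a torus_L2" is "\<lambda>x. 0"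
  by (simp add: square_integrable_0)

lift_definition plus_torus_L2 :: "'a torus_L2 \<Rightarrow> 'a torus_L2 \<Rightarrow> 'a torus_L2"
  is "\<lambda>f g x. f x + g x"
  by (auto intro: square_integrable_add)

lift_definition uminus_torus_L2 :: "'a torus_L2 \<Rightarrow> 'a torus_L2" is "\<lambda>f x. - f x"
  using square_integrable_scale[of _ "-1"] by (auto)

lift_definition minus_torus_L2 :: "'a torus_L2 \<Rightarrow> 'a torus_L2 \<Rightarrow> 'a torus_L2"
  is "\<lambda>f g x. f x - g x"
  using square_integrable_add[OF _ square_integrable_scale[of _ "-1"]] by (auto)

lift_definition scaleR_torus_L2 :: "real \<Rightarrow> 'a torus_L2 \<Rightarrow> 'a torus_L2"
  is "\<lambda>r f x. of_real r * f x"
  by (auto intro: square_integrable_scale)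

lift_definition inner_torus_L2 :: "'a torus_L2 \<Rightarrow> 'a torus_L2 \<Rightarrow> real"
  is "\<lambda>f g. Re (\<integral>x. f x * cnj (g x) \<partial>torus_measure)"
  by (rule arg_cong[of _ _ Re], rule integral_cong_AE)
     (auto dest: square_integrable_mult_cnj intro: borel_measurable_integrable)

lift_definition norm_torus_L2 :: "'a torus_L2 \<Rightarrow> real"
  is "\<lambda>f. sqrt (\<integral>x. (cmod (f x))\<^sup>2 \<partial>torus_measure)"
  by (rule arg_cong[of _ _ sqrt], rule integral_cong_AE)
     (auto simp: square_integrable_def intro: borel_measurable_integrable)

definition "sgn (f :: 'a torus_L2) = scaleR (inverse (norm f)) f"

definition "dist (f :: 'a torus_L2) g = norm (f - g)"

definition [code del]:
  "(uniformity :: ('a torus_L2 \<times> 'a torus_L2) filter) =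
    (INF e\<in>{0<..}. principal {(f, g). dist f g < e})"

definition [code del]:
  "open (U :: 'a torus_L2 set) \<longleftrightarrow>
    (\<forall>f\<in>U. \<forall>\<^sub>F (f', g) in uniformity. f' = f \<longrightarrow> g \<in> U)"

instance
proof
  fix a b c :: "'a torus_L2" and r s :: real
  have add: "integrable torus_measure (\<lambda>x. f x * cnj (g x))"
    if "square_integrable f" "square_integrable g" for f g :: "real ^ 'a \<Rightarrow> complex"
    using that by (rule square_integrable_mult_cnj)
  note sq = square_integrable_add square_integrable_scale square_integrable_0
    square_integrable_scale[of _ "-1", simplified]
    square_integrable_add[OF _ square_integrable_scale[of _ "-1"], simplified]
  show "a + b + c = a + (b + c)"
    by transfer (auto simp: add.assoc intro!: sq)
  show "a + b = b + a"
    by transfer (auto simp: add.commute intro!: sq)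
  show "0 + a = a"
    by transfer (auto intro!: sq)
  show "- a + a = 0"
    by transfer (auto intro!: sq)
  show "a - b = a + - b"
    by transfer (auto intro!: sq)
  show "r *\<^sub>R (a + b) = r *\<^sub>R a + r *\<^sub>R b"
    by transfer (auto simp: distrib_left distrib_right intro!: sq)
  show "(r + s) *\<^sub>R a = r *\<^sub>R a + s *\<^sub>R a"
    by transfer (auto simp: distrib_left distrib_right intro!: sq)
  show "r *\<^sub>R s *\<^sub>R a = (r * s) *\<^sub>R a"
    by transfer (auto simp: mult.assoc intro!: sq)
  show "1 *\<^sub>R a = a"
    by transfer (auto intro!: sq)
  show "dist a b = norm (a - b)"
    by (simp add: dist_torus_L2_def)
  show "sgn a = scaleR (inverse (norm a)) a"
    by (simp add: sgn_torus_L2_def)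
  show "(uniformity :: ('a torus_L2 \<times> 'a torus_L2) filter) =
      (INF e\<in>{0<..}. principal {(f, g). dist f g < e})"
    by (simp add: uniformity_torus_L2_def)
  show "open U \<longleftrightarrow> (\<forall>f\<in>U. \<forall>\<^sub>F (f', g) in uniformity. f' = f \<longrightarrow> g \<in> U)"
    for U :: "'a torus_L2 set"
    by (simp add: open_torus_L2_def)
  show "inner a b = inner b a"
  proof transfer
    fix f g :: "real ^ 'a \<Rightarrow> complex"
    have "(\<integral>x. g x * cnj (f x) \<partial>torus_measure) = cnj (\<integral>x. f x * cnj (g x) \<partial>torus_measure)"
      by (subst Bochner_Integration.integral_cnj [symmetric]) (simp add: mult.commute)
    then show "Re (\<integral>x. f x * cnj (g x) \<partial>torus_measure) = Re (\<integral>x. g x * cnj (f x) \<partial>torus_measure)"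
      by simp
  qed
  show "inner (a + b) c = inner a c + inner b c"
    by transfer (simp add: add distrib_right)
  show "inner (r *\<^sub>R a) b = r * inner a b"
    by transfer (simp add: mult.assoc)
  have cmod2: "(\<integral>x. f x * cnj (f x) \<partial>torus_measure) =
      complex_of_real (\<integral>x. (cmod (f x))\<^sup>2 \<partial>torus_measure)" for f :: "real ^ 'a \<Rightarrow> complex"
    by (simp only: integral_complex_of_real [symmetric] complex_norm_square)
  show "0 \<le> inner a a"
    by transfer (simp only: cmod2 Re_complex_of_real, simp)
  show "inner a a = 0 \<longleftrightarrow> a = 0"
  proof transfer
    fix f :: "real ^ 'a \<Rightarrow> complex"
    assume "square_integrable f \<and> square_integrable f \<and> (AE x in torus_measure. f x = f x)"
    then show "Re (\<integral>x. f x * cnj (f x) \<partial>torus_measure) = 0 \<longleftrightarrow>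
        square_integrable f \<and> square_integrable (\<lambda>x. 0 :: complex) \<and> (AE x in torus_measure. f x = 0)"
      by (simp add: cmod2 square_integrable_def integral_nonneg_eq_0_iff_AE)
  qed
  show "norm a = sqrt (inner a a)"
    by transfer (simp add: cmod2)
qed

end

lift_definition scaleC :: "complex \<Rightarrow> 'd::finite torus_L2 \<Rightarrow> 'd torus_L2"
  is "\<lambda>c f x. c * f x"
  by (auto intro: square_integrable_scale)

lift_definition conj_L2 :: "'d::finite torus_L2 \<Rightarrow> 'd torus_L2" is "\<lambda>f x. cnj (f x)"
  by (auto intro: square_integrable_cnj)

(* The complex L2 inner product; its real part is the inner product of class real_inner. *)
lift_definition cinner :: "'d::finite torus_L2 \<Rightarrow> 'd torus_L2 \<Rightarrow> complex"
  is "\<lambda>f g. \<integral>x. f x * cnj (g x) \<partial>torus_measure"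
  by (rule integral_cong_AE)
     (auto dest: square_integrable_mult_cnj intro: borel_measurable_integrable)

lemma measurable_character:
  "(\<lambda>x::real ^ 'd. cis (- (\<Sum>i\<in>UNIV. of_int (k $ i) * x $ i))) \<in> borel_measurable torus_measure"
proof -
  have "(\<lambda>x::real ^ 'd. cis (- (\<Sum>i\<in>UNIV. of_int (k $ i) * x $ i))) \<in> borel_measurable borel"
    by (intro borel_measurable_continuous_onI continuous_intros)
  then show ?thesis
    by (simp add: torus_measure_def measurable_restrict_space1)
qed

lift_definition fourier_coeff :: "'d::finite torus_L2 \<Rightarrow> int ^ 'd \<Rightarrow> complex"
  is "\<lambda>f k. (\<integral>x. f x * cis (- (\<Sum>i\<in>UNIV. of_int (k $ i) * x $ i)) \<partial>torus_measure)
        / (2 * pi) ^ CARD('d)"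
  by (rule ext, rule arg_cong[of _ _ "\<lambda>z. z / _"], rule integral_cong_AE)
     (auto simp: square_integrable_def intro!: borel_measurable_times measurable_character)

definition sobolev :: "nat \<Rightarrow> 'd::finite torus_L2 set"
  where "sobolev s =
    {f. (\<lambda>k. (1 + (\<Sum>i\<in>UNIV. (of_int (k $ i))\<^sup>2)) ^ s * (cmod (fourier_coeff f k))\<^sup>2)
          summable_on UNIV}"

(* A possibly unbounded operator is a domain together with an action; the values of the action
   outside the domain carry no meaning. *)
datatype 'd L2_operator =
  L2_Operator (op_dom: "'d::finite torus_L2 set") (op_app: "'d torus_L2 \<Rightarrow> 'd torus_L2")

definition op_add :: "'d::finite L2_operator \<Rightarrow> 'd L2_operator \<Rightarrow> 'd L2_operator"
  where "op_add A B = L2_Operator (op_dom A \<inter> op_dom B) (\<lambda>w. op_app A w + op_app B w)"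

definition op_diff :: "'d::finite L2_operator \<Rightarrow> 'd L2_operator \<Rightarrow> 'd L2_operator"
  where "op_diff A B = L2_Operator (op_dom A \<inter> op_dom B) (\<lambda>w. op_app A w - op_app B w)"

definition linear_op :: "'d::finite L2_operator \<Rightarrow> bool"
  where "linear_op A \<longleftrightarrow>
    0 \<in> op_dom A \<and>
    (\<forall>v\<in>op_dom A. \<forall>w\<in>op_dom A. v + w \<in> op_dom A \<and> op_app A (v + w) = op_app A v + op_app A w) \<and>
    (\<forall>c. \<forall>w\<in>op_dom A. scaleC c w \<in> op_dom A \<and> op_app A (scaleC c w) = scaleC c (op_app A w))"

(* The last conjunct says that A and its adjoint have the same graph. Its right-hand side is the
   weak form of "A w = z", so for a self-adjoint operator acting weakly with a value in L2 and
   acting strongly are the same thing. *)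
definition self_adjoint :: "'d::finite L2_operator \<Rightarrow> bool"
  where "self_adjoint A \<longleftrightarrow> linear_op A \<and> closure (op_dom A) = UNIV \<and>
    (\<forall>w z. w \<in> op_dom A \<and> op_app A w = z \<longleftrightarrow> (\<forall>x\<in>op_dom A. cinner (op_app A x) w = cinner x z))"

(* The norm as an operator from L2 to L2: a densely defined operator bounded on its domain extends
   uniquely to all of L2, with the same norm; any other operator has norm infinity. *)
definition op_norm :: "'d::finite L2_operator \<Rightarrow> ennreal"
  where "op_norm A =
    (if closure (op_dom A) = UNIV
     then (SUP w\<in>{w \<in> op_dom A. norm w \<le> 1}. ennreal (norm (op_app A w)))
     else \<infinity>)"

(* Multiplication by a function phi with its maximal domain, which is empty if phi is not
   measurable. *)
lift_definition in_mult_dom :: "(real ^ 'd \<Rightarrow> complex) \<Rightarrow> 'd::finite torus_L2 \<Rightarrow> bool"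
  is "\<lambda>\<phi> w. \<phi> \<in> borel_measurable torus_measure \<and> square_integrable (\<lambda>x. \<phi> x * w x)"
proof -
  fix \<phi> v w :: "real ^ 'd \<Rightarrow> complex"
  assume "square_integrable v \<and> square_integrable w \<and> (AE x in torus_measure. v x = w x)"
  moreover have "integrable torus_measure (\<lambda>x. (cmod (\<phi> x * v x))\<^sup>2) \<longleftrightarrow>
      integrable torus_measure (\<lambda>x. (cmod (\<phi> x * w x))\<^sup>2)"
    if "\<phi> \<in> borel_measurable torus_measure" "v \<in> borel_measurable torus_measure"
      "w \<in> borel_measurable torus_measure" "AE x in torus_measure. v x = w x"
    using that by (intro integrable_cong_AE) auto
  ultimately show "(\<phi> \<in> borel_measurable torus_measure \<and> square_integrable (\<lambda>x. \<phi> x * v x)) =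
      (\<phi> \<in> borel_measurable torus_measure \<and> square_integrable (\<lambda>x. \<phi> x * w x))"
    by (auto simp: square_integrable_def)
qed

lift_definition mult_app :: "(real ^ 'd \<Rightarrow> complex) \<Rightarrow> 'd::finite torus_L2 \<Rightarrow> 'd torus_L2"
  is "\<lambda>\<phi> w. if \<phi> \<in> borel_measurable torus_measure \<and> square_integrable (\<lambda>x. \<phi> x * w x)
      then (\<lambda>x. \<phi> x * w x) else (\<lambda>x. 0)"
proof -
  fix \<phi> v w :: "real ^ 'd \<Rightarrow> complex"
  assume vw: "square_integrable v \<and> square_integrable w \<and> (AE x in torus_measure. v x = w x)"
  let ?m = "\<lambda>w. \<phi> \<in> borel_measurable torus_measure \<and> square_integrable (\<lambda>x. \<phi> x * w x)"
  let ?p = "\<lambda>w. if ?m w then (\<lambda>x. \<phi> x * w x) else (\<lambda>x. 0)"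
  have "?m v = ?m w"
    using vw in_mult_dom.rsp[of] by (auto simp: rel_fun_def)
  then show "square_integrable (?p v) \<and> square_integrable (?p w) \<and>
      (AE x in torus_measure. ?p v x = ?p w x)"
    using vw by (auto simp: square_integrable_0)
qed

definition mult_op :: "(real ^ 'd \<Rightarrow> complex) \<Rightarrow> 'd::finite L2_operator"
  where "mult_op \<phi> = L2_Operator {w. in_mult_dom \<phi> w} (mult_app \<phi>)"

(* w is a solution of i w'(t) = A(t) w(t) on J; the derivative is taken in L2. *)
definition solves_on :: "real set \<Rightarrow> (real \<Rightarrow> 'd::finite L2_operator) \<Rightarrow> (real \<Rightarrow> 'd torus_L2) \<Rightarrow> bool"
  where "solves_on J A w \<longleftrightarrow>
    (\<forall>t\<in>J. w t \<in> op_dom (A t) \<and>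
      (\<exists>w'. (w has_vector_derivative w') (at t within J) \<and>
        scaleC \<i> w' = op_app (A t) (w t)))"

(* C is an admissible value of G'(v); the radius r makes the requirement that the norm of delta
   be small precise. *)
definition frechet_constant ::
    "('d::finite torus_L2 \<Rightarrow> 'd L2_operator) \<Rightarrow> 'd torus_L2 \<Rightarrow> real \<Rightarrow> real \<Rightarrow> bool"
  where "frechet_constant G v C r \<longleftrightarrow>
    (\<forall>\<delta>\<in>sobolev 2. norm \<delta> < r \<longrightarrow> op_norm (op_diff (G (v + \<delta>)) (G v)) \<le> ennreal (C * norm \<delta>))"

end

theory Submission
  imports Defs
begin

text \<open>
  The error \<open>e = U (k + 1) - u\<close> satisfies an equation with the generator of the new iterate,
  driven by the defect of the exact solution in that equation:
  \<open>\<i> e' = G (U k) e + (G (U k) - G u) u\<close>. Self-adjointness makes the first term on the right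
  invisible in the energy identity for \<open>norm e\<close>, so \<open>norm e\<close> grows at most at the rate
  \<open>norm ((G (U k) - G u) u)\<close> (\<open>solution_difference_le\<close>). The Frechet inequality bounds this rate by
  \<open>C * \<rho> k * norm u\<close>, and \<open>norm u\<close> never exceeds its initial value (\<open>solution_norm_le\<close>). As
  \<open>e\<close> vanishes at the left end of the step, one iteration multiplies a uniform error bound by
  \<open>C * norm u * h\<close>. Induction starting from the bound on the first iterate gives the estimate, and
  the estimate is geometric in \<open>k\<close> with ratio \<open>C * norm u * h\<close>, which gives convergence.

  The equation for \<open>e\<close> makes sense only if \<open>u\<close> lies in the domain of \<open>G (U k)\<close>, whereas solving its
  own equation puts \<open>u\<close> only in the domain of \<open>G u\<close>; likewise the operator norm controls
  \<open>G (U k) - G u\<close> only on the intersection of the two domains. Both gaps are closed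
  by the multiplicative form of the nonlinearity: the common part \<open>L\<close> cancels in the difference,
  which is therefore multiplication by a function and is bounded on a dense subspace. Such a
  multiplication is defined and bounded on all of \<open>L\<^sub>2\<close> (\<open>bounded_multiplication_extends\<close>), so the two
  generators have the same domain and the estimate applies to \<open>u\<close> (\<open>perturbed_operator_domain\<close>).
\<close>

section \<open>Growth of the norm of a curve in an inner product space\<close>

text \<open>
  For a nonzero \<^term>\<open>e t\<close> the hypothesis says that the derivative of the norm,
  \<open>inner (e' t) (e t) / norm (e t)\<close>, is at most \<^term>\<open>M\<close>. The norm need not be differentiable
  at zeros of \<open>e\<close>, and the errors studied below start at zero, so the argument is applied to the
  regularised norm \<open>sqrt ((norm (e t))\<^sup>2 + \<epsilon>\<^sup>2)\<close>, which obeys the same bound on its slope; then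
  \<open>\<epsilon>\<close> tends to 0.
\<close>

lemma norm_growth_bound:
  fixes e :: "real \<Rightarrow> 'a::real_inner"
  assumes deriv: "\<And>t. t \<in> {a..b} \<Longrightarrow> (e has_vector_derivative e' t) (at t within {a..b})"
    and bound: "\<And>t. t \<in> {a..b} \<Longrightarrow> inner (e' t) (e t) \<le> M * norm (e t)"
    and "0 \<le> M" and t: "t \<in> {a..b}"
  shows "norm (e t) \<le> norm (e a) + M * (t - a)"
proof (rule field_le_epsilon)
  fix \<epsilon> :: real
  assume \<epsilon>: "0 < \<epsilon>"
  define q where "q = (\<lambda>t. sqrt ((norm (e t))\<^sup>2 + \<epsilon>\<^sup>2))"
  have pos: "0 < (norm (e x))\<^sup>2 + \<epsilon>\<^sup>2" for x
    using \<epsilon> by (simp add: add_nonneg_pos)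
  have norm_le: "norm (e x) \<le> q x" for x
    unfolding q_def by (rule real_le_rsqrt) simp
  have q_pos: "0 < q x" for x
    using pos by (simp add: q_def)
  have dq: "(q has_derivative (\<lambda>y. y * (inner (e' x) (e x) / q x))) (at x within {a..t})"
    if x: "x \<in> {a..t}" for x
  proof -
    have "(e has_derivative (\<lambda>y. y *\<^sub>R e' x)) (at x within {a..t})"
      using deriv[of x] x t
      by (auto simp: has_vector_derivative_def intro: has_derivative_subset)
    then have "((\<lambda>x. inner (e x) (e x) + \<epsilon>\<^sup>2) has_derivative
        (\<lambda>y. inner (e x) (y *\<^sub>R e' x) + inner (y *\<^sub>R e' x) (e x))) (at x within {a..t})"
      by (auto intro!: derivative_eq_intros)
    then have "((\<lambda>x. sqrt (inner (e x) (e x) + \<epsilon>\<^sup>2)) has_derivative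
        (\<lambda>y. (inner (e x) (y *\<^sub>R e' x) + inner (y *\<^sub>R e' x) (e x)) *
          (inverse (sqrt (inner (e x) (e x) + \<epsilon>\<^sup>2)) / 2))) (at x within {a..t})"
      using pos[of x] unfolding power2_norm_eq_inner
      by (intro has_derivative_real_sqrt[THEN has_derivative_eq_rhs]) (auto simp: field_simps)
    then show ?thesis
      by (simp add: q_def power2_norm_eq_inner inner_commute field_simps)
  qed
  have slope: "inner (e' x) (e x) / q x \<le> M" if "x \<in> {a..t}" for x
  proof -
    have "inner (e' x) (e x) \<le> M * norm (e x)"
      using bound[of x] that t by auto
    also have "\<dots> \<le> M * q x"
      using norm_le[of x] \<open>0 \<le> M\<close> by (rule mult_left_mono)
    finally show ?thesis
      using q_pos[of x] by (simp add: divide_le_eq)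
  qed
  have "q t \<le> q a + M * (t - a)"
  proof (cases "a = t")
    case False
    then have "a < t" using t by auto
    then obtain x where "x \<in> {a<..<t}" and x: "q t - q a = (t - a) * (inner (e' x) (e x) / q x)"
      using mvt_simple[of a t q "\<lambda>x y. y * (inner (e' x) (e x) / q x)"] dq by auto
    then have "q t - q a \<le> (t - a) * M"
      using slope[of x] \<open>a < t\<close> by (simp only: x) (intro mult_left_mono, auto)
    then show ?thesis by (simp add: algebra_simps)
  qed simp
  moreover have "q a \<le> norm (e a) + \<epsilon>"
    unfolding q_def using \<epsilon> sqrt_sum_squares_le_sum[of "norm (e a)" \<epsilon>] by simp
  ultimately show "norm (e t) \<le> norm (e a) + M * (t - a) + \<epsilon>"
    using norm_le[of t] by linarith
qed

section \<open>Representatives of square-integrable classes\<close>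

lemma obtain_representative:
  fixes w :: "'d::finite torus_L2"
  obtains f where "square_integrable f" "w = abs_torus_L2 f"
  using that[of "rep_torus_L2 w"] Quotient_abs_rep[OF Quotient_torus_L2, of w]
    Quotient_rep_reflp[OF Quotient_torus_L2, of w]
  by simp

lemma square_integrable_diff:
  "square_integrable f \<Longrightarrow> square_integrable g \<Longrightarrow> square_integrable (\<lambda>x. f x - g x)"
  using square_integrable_add[OF _ square_integrable_scale[of g "- 1"]] by simp

lemma norm_abs_torus_L2:
  "square_integrable f \<Longrightarrow> norm (abs_torus_L2 f) = sqrt (\<integral>x. (cmod (f x))\<^sup>2 \<partial>torus_measure)"
  by (subst norm_torus_L2.abs_eq) auto

lemma nn_integral_square:
  assumes "square_integrable f"
  shows "(\<integral>\<^sup>+x. ennreal ((cmod (f x))\<^sup>2) \<partial>torus_measure) = ennreal ((norm (abs_torus_L2 f))\<^sup>2)"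
  using assms
  by (subst nn_integral_eq_integral) (auto simp: square_integrable_def norm_abs_torus_L2)

section \<open>The complex inner product\<close>

lemma inner_eq_Re_cinner: "inner v w = Re (cinner v w)"
  by transfer simp

lemma cinner_add_left: "cinner (v + w) z = cinner v z + cinner w z"
  by transfer (simp add: square_integrable_mult_cnj distrib_right)

lemma cinner_scaleC_left: "cinner (scaleC c v) w = c * cinner v w"
  by transfer (simp add: mult.assoc)

lemma cinner_commute: "cinner v w = cnj (cinner w v)"
  by transfer (subst Bochner_Integration.integral_cnj [symmetric], simp add: mult.commute)

lemma scaleC_of_real: "scaleC (of_real c) w = c *\<^sub>R w"
  by transfer (auto intro: square_integrable_scale)

lemma scaleC_scaleC: "scaleC a (scaleC b w) = scaleC (a * b) w"
  by transfer (auto simp: mult.assoc intro: square_integrable_scale)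

lemma scaleC_diff: "scaleC c (v - w) = scaleC c v - scaleC c w"
  by transfer (auto simp: right_diff_distrib intro!: square_integrable_diff square_integrable_scale)

lemma norm_scaleC: "norm (scaleC c w) = cmod c * norm w"
  by transfer (simp add: norm_mult power_mult_distrib real_sqrt_mult)

lemma scaleC_minus_one: "scaleC (- 1) w = - w"
  using scaleC_of_real[of "- 1" w] by simp

text \<open>
  Solutions are specified through \<open>\<i> w' = z\<close>; the energy identity needs \<open>w'\<close> itself, and then reads
  off the imaginary part of \<open>cinner z w\<close>.
\<close>

lemma solution_velocity:
  assumes "scaleC \<i> w' = z"
  shows "w' = scaleC (- \<i>) z"
  using assms scaleC_of_real[of 1 w'] by (auto simp: scaleC_scaleC)

lemma inner_solution_velocity: "inner (scaleC (- \<i>) z) w = Im (cinner z w)"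
  by (simp add: inner_eq_Re_cinner cinner_scaleC_left)

text \<open>
  This is the real Cauchy-Schwarz inequality for \<open>- \<i> z\<close>, whose norm is that of \<open>z\<close>.
\<close>

lemma Im_cinner_le: "Im (cinner z w) \<le> norm z * norm w"
  using norm_cauchy_schwarz[of "scaleC (- \<i>) z" w]
  by (simp add: inner_solution_velocity norm_scaleC)

section \<open>Self-adjoint, linear and bounded operators\<close>

text \<open>
  Testing membership of \<open>w\<close> in the domain of the adjoint against \<open>w\<close> itself shows that
  \<open>cinner (op_app A w) w\<close> equals its own conjugate.
\<close>

lemma self_adjoint_Im_cinner:
  assumes "self_adjoint A" "w \<in> op_dom A"
  shows "Im (cinner (op_app A w) w) = 0"
proof -
  have "cinner (op_app A w) w = cinner w (op_app A w)"
    using assms by (auto simp: self_adjoint_def)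
  then show ?thesis
    using cinner_commute[of w "op_app A w"] by (metis Im_complex_of_real cnj.simps(2) equal_neg_zero)
qed

lemma linear_op_diff:
  assumes "linear_op A" "v \<in> op_dom A" "w \<in> op_dom A"
  shows "v - w \<in> op_dom A \<and> op_app A (v - w) = op_app A v - op_app A w"
proof -
  have "scaleC (- 1) w \<in> op_dom A \<and> op_app A (scaleC (- 1) w) = scaleC (- 1) (op_app A w)"
    using assms unfolding linear_op_def by blast
  moreover from this have "v + scaleC (- 1) w \<in> op_dom A \<and>
      op_app A (v + scaleC (- 1) w) = op_app A v + op_app A (scaleC (- 1) w)"
    using assms unfolding linear_op_def by blast
  ultimately show ?thesis
    by (simp add: scaleC_minus_one)
qed

lemma linear_op_op_diff:
  assumes "linear_op A" "linear_op B"
  shows "linear_op (op_diff A B)"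
  using assms by (simp add: linear_op_def op_diff_def scaleC_diff)

text \<open>
  The supremum in the operator norm runs over the unit ball of the domain only; homogeneity carries
  the bound over to the whole domain. A finite norm also carries the information that the domain is
  dense, which is what lets the bound be extended beyond it later.
\<close>

lemma op_norm_le_imp_bound:
  assumes lin: "linear_op A" and norm: "op_norm A \<le> ennreal K" and "0 \<le> K"
  shows "closure (op_dom A) = UNIV"
    and "w \<in> op_dom A \<Longrightarrow> norm (op_app A w) \<le> K * norm w"
proof -
  show cl: "closure (op_dom A) = UNIV"
    using norm by (auto simp: op_norm_def top_unique split: if_splits)
  have unit: "norm (op_app A w) \<le> K" if "w \<in> op_dom A" "norm w \<le> 1" for w
  proof -
    have "ennreal (norm (op_app A w)) \<le> op_norm A"
      using that cl by (auto simp: op_norm_def intro!: SUP_upper)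
    then have "ennreal (norm (op_app A w)) \<le> ennreal K"
      using norm by (rule order_trans)
    then show ?thesis
      using \<open>0 \<le> K\<close> by (simp add: ennreal_le_iff)
  qed
  have scale: "c *\<^sub>R w \<in> op_dom A \<and> op_app A (c *\<^sub>R w) = c *\<^sub>R op_app A w" if "w \<in> op_dom A" for c w
    using lin that unfolding linear_op_def scaleC_of_real[symmetric] by blast
  show "norm (op_app A w) \<le> K * norm w" if w: "w \<in> op_dom A"
  proof (cases "w = 0")
    case True
    then show ?thesis using scale[OF w, of 0] by simp
  next
    case False
    then have "norm (op_app A (inverse (norm w) *\<^sub>R w)) \<le> K"
      using scale[OF w] by (intro unit) auto
    then show ?thesis
      using scale[OF w] False by (simp add: field_simps)
  qed
qed

section \<open>Multiplication operators\<close>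

lemma in_mult_dom_abs:
  "square_integrable f \<Longrightarrow> in_mult_dom \<phi> (abs_torus_L2 f) \<longleftrightarrow>
    \<phi> \<in> borel_measurable torus_measure \<and> square_integrable (\<lambda>x. \<phi> x * f x)"
  by (subst in_mult_dom.abs_eq) auto

lemma mult_app_abs:
  "square_integrable f \<Longrightarrow> in_mult_dom \<phi> (abs_torus_L2 f) \<Longrightarrow>
    mult_app \<phi> (abs_torus_L2 f) = abs_torus_L2 (\<lambda>x. \<phi> x * f x)"
  by (subst mult_app.abs_eq) (auto simp: in_mult_dom_abs)

lemma mult_add:
  assumes "in_mult_dom \<phi> w" "in_mult_dom \<psi> w"
  shows "in_mult_dom (\<lambda>x. \<phi> x + \<psi> x) w \<and>
    mult_app (\<lambda>x. \<phi> x + \<psi> x) w = mult_app \<phi> w + mult_app \<psi> w"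
  using assms
  by transfer (auto simp: distrib_right intro!: square_integrable_add)

lemma mult_diff:
  assumes "in_mult_dom \<phi> w" "in_mult_dom \<psi> w"
  shows "in_mult_dom (\<lambda>x. \<phi> x - \<psi> x) w \<and>
    mult_app (\<lambda>x. \<phi> x - \<psi> x) w = mult_app \<phi> w - mult_app \<psi> w"
  using assms
  by transfer (auto simp: left_diff_distrib intro!: square_integrable_diff)

text \<open>
  Convergence in \<open>L\<^sub>2\<close> is convergence in \<open>L\<^sub>1\<close> of the squared distances to 0, to which the
  corresponding theorem for \<open>L\<^sub>1\<close> applies.
\<close>

lemma L2_convergence_AE_subseq:
  assumes "\<And>n. square_integrable (f n)" "square_integrable f0"
    and "(\<lambda>n. abs_torus_L2 (f n)) \<longlonglongrightarrow> abs_torus_L2 f0"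
  obtains \<sigma> where "strict_mono \<sigma>" "AE x in torus_measure. (\<lambda>n. f (\<sigma> n) x) \<longlonglongrightarrow> f0 x"
proof -
  have sq: "square_integrable (\<lambda>x. f n x - f0 x)" for n
    using assms(1,2) by (rule square_integrable_diff)
  have "abs_torus_L2 (f n) - abs_torus_L2 f0 = abs_torus_L2 (\<lambda>x. f n x - f0 x)" for n
    using assms by (intro minus_torus_L2.abs_eq) auto
  then have "(\<integral>x. norm ((cmod (f n x - f0 x))\<^sup>2) \<partial>torus_measure) =
      (norm (abs_torus_L2 (f n) - abs_torus_L2 f0))\<^sup>2" for n
    by (simp add: norm_abs_torus_L2[OF sq])
  moreover have "(\<lambda>n. (norm (abs_torus_L2 (f n) - abs_torus_L2 f0))\<^sup>2) \<longlonglongrightarrow> 0"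
    using tendsto_power[OF tendsto_norm_zero[OF LIM_zero[OF assms(3)]], of 2] by simp
  ultimately have "\<exists>\<sigma>. strict_mono \<sigma> \<and>
      (AE x in torus_measure. (\<lambda>n. (cmod (f (\<sigma> n) x - f0 x))\<^sup>2) \<longlonglongrightarrow> 0)"
    using sq by (intro tendsto_L1_AE_subseq) (auto simp: square_integrable_def)
  then obtain \<sigma> where \<sigma>: "strict_mono \<sigma>"
      "AE x in torus_measure. (\<lambda>n. (cmod (f (\<sigma> n) x - f0 x))\<^sup>2) \<longlonglongrightarrow> 0"
    by auto
  have "(\<lambda>n. f (\<sigma> n) x) \<longlonglongrightarrow> f0 x"
    if "(\<lambda>n. (cmod (f (\<sigma> n) x - f0 x))\<^sup>2) \<longlonglongrightarrow> 0" for x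
    using tendsto_real_sqrt[OF that] by (simp add: tendsto_norm_zero_iff LIM_zero_iff)
  with \<sigma> show ?thesis
    by (intro that) auto
qed

text \<open>
  Approximate \<open>w\<close> by elements of \<open>D\<close> whose representatives converge almost everywhere. Pointwise
  multiplication by \<open>\<phi>\<close> preserves this convergence, so by Fatou's lemma the integral of
  \<open>(cmod (\<phi> x * w x))\<^sup>2\<close> is at most the lower limit of the corresponding integrals for the
  approximants, which the bound on \<open>D\<close> controls. The same inequality gives both membership in the
  domain and the norm bound.
\<close>

lemma bounded_multiplication_extends:
  fixes D :: "'d::finite torus_L2 set"
  assumes dense: "closure D = UNIV"
    and dom: "\<And>w. w \<in> D \<Longrightarrow> in_mult_dom \<phi> w"
    and bound: "\<And>w. w \<in> D \<Longrightarrow> norm (mult_app \<phi> w) \<le> K * norm w"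
  shows "in_mult_dom \<phi> w \<and> norm (mult_app \<phi> w) \<le> K * norm w"
proof -
  obtain f0 where f0: "square_integrable f0" "w = abs_torus_L2 f0"
    by (rule obtain_representative)
  obtain v where v: "\<And>n. v n \<in> D" "v \<longlonglongrightarrow> w"
    using closure_sequential[of w D] UNIV_I[of w] unfolding dense by blast
  have "\<exists>f. square_integrable f \<and> v n = abs_torus_L2 f" for n
    by (rule obtain_representative[of "v n"]) (intro exI conjI)
  then obtain f where f: "\<And>n. square_integrable (f n)" "\<And>n. v n = abs_torus_L2 (f n)"
    by metis
  have "(\<lambda>n. abs_torus_L2 (f n)) \<longlonglongrightarrow> abs_torus_L2 f0"
    using v(2) by (simp only: f(2)[symmetric] f0(2)[symmetric])
  then obtain \<sigma> where
    \<sigma>: "strict_mono \<sigma>" "AE x in torus_measure. (\<lambda>n. f (\<sigma> n) x) \<longlonglongrightarrow> f0 x"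
    by (rule L2_convergence_AE_subseq[OF f(1) f0(1)])
  have \<phi>f: "square_integrable (\<lambda>x. \<phi> x * f n x)"
      and \<phi>: "\<phi> \<in> borel_measurable torus_measure"
      and app: "mult_app \<phi> (v n) = abs_torus_L2 (\<lambda>x. \<phi> x * f n x)" for n
    using dom[OF v(1)[of n]] in_mult_dom_abs[OF f(1)[of n], of \<phi>]
      mult_app_abs[OF f(1)[of n], of \<phi>] f(2)[of n] by simp_all
  have meas: "(\<lambda>x. \<phi> x * f0 x) \<in> borel_measurable torus_measure"
    using \<phi> f0(1) by (intro borel_measurable_times) (simp_all add: square_integrable_def)
  have "(\<integral>\<^sup>+x. ennreal ((cmod (\<phi> x * f0 x))\<^sup>2) \<partial>torus_measure) =
      (\<integral>\<^sup>+x. liminf (\<lambda>n. ennreal ((cmod (\<phi> x * f (\<sigma> n) x))\<^sup>2)) \<partial>torus_measure)"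
  proof (rule nn_integral_cong_AE, use \<sigma>(2) in eventually_elim)
    fix x assume "(\<lambda>n. f (\<sigma> n) x) \<longlonglongrightarrow> f0 x"
    then have "(\<lambda>n. ennreal ((cmod (\<phi> x * f (\<sigma> n) x))\<^sup>2)) \<longlonglongrightarrow> ennreal ((cmod (\<phi> x * f0 x))\<^sup>2)"
      by (intro tendsto_ennrealI tendsto_intros)
    then show "ennreal ((cmod (\<phi> x * f0 x))\<^sup>2) = liminf (\<lambda>n. ennreal ((cmod (\<phi> x * f (\<sigma> n) x))\<^sup>2))"
      by (rule lim_imp_Liminf[OF sequentially_bot, symmetric])
  qed
  also have "\<dots> \<le> liminf (\<lambda>n. \<integral>\<^sup>+x. ennreal ((cmod (\<phi> x * f (\<sigma> n) x))\<^sup>2) \<partial>torus_measure)"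
  proof (rule nn_integral_liminf)
    fix n
    have [measurable]: "(\<lambda>x. \<phi> x * f (\<sigma> n) x) \<in> borel_measurable torus_measure"
      using \<phi>f[of "\<sigma> n"] by (simp add: square_integrable_def)
    show "(\<lambda>x. ennreal ((cmod (\<phi> x * f (\<sigma> n) x))\<^sup>2)) \<in> borel_measurable torus_measure"
      by measurable
  qed
  also have "\<dots> = liminf (\<lambda>n. ennreal ((norm (mult_app \<phi> (v (\<sigma> n))))\<^sup>2))"
    by (simp only: nn_integral_square[OF \<phi>f] app)
  also have "\<dots> \<le> liminf (\<lambda>n. ennreal ((K * norm (v (\<sigma> n)))\<^sup>2))"
    by (intro Liminf_mono always_eventually allI ennreal_leI power_mono bound v(1) norm_ge_zero)
  also have "\<dots> = ennreal ((K * norm w)\<^sup>2)"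
    using LIMSEQ_subseq_LIMSEQ[OF v(2) \<sigma>(1)] unfolding o_def
    by (intro lim_imp_Liminf sequentially_bot tendsto_ennrealI tendsto_intros)
  finally have le: "(\<integral>\<^sup>+x. ennreal ((cmod (\<phi> x * f0 x))\<^sup>2) \<partial>torus_measure) \<le> ennreal ((K * norm w)\<^sup>2)" .
  have "integrable torus_measure (\<lambda>x. (cmod (\<phi> x * f0 x))\<^sup>2)"
  proof (rule integrableI_bounded)
    show "(\<lambda>x. (cmod (\<phi> x * f0 x))\<^sup>2) \<in> borel_measurable torus_measure"
      using meas by measurable
    show "(\<integral>\<^sup>+x. ennreal (norm ((cmod (\<phi> x * f0 x))\<^sup>2)) \<partial>torus_measure) < \<infinity>"
      using le_less_trans[OF le ennreal_less_top] by simp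
  qed
  then have sq: "square_integrable (\<lambda>x. \<phi> x * f0 x)"
    using meas by (simp add: square_integrable_def)
  then have in_dom: "in_mult_dom \<phi> w"
    using \<phi> f0 by (simp add: in_mult_dom_abs)
  have "0 \<le> K * norm (v n)" for n
    by (rule order_trans[OF norm_ge_zero bound[OF v(1)]])
  moreover have "(\<lambda>n. K * norm (v n)) \<longlonglongrightarrow> K * norm w"
    using v(2) by (intro tendsto_intros)
  ultimately have "0 \<le> K * norm w"
    using LIMSEQ_le_const by blast
  moreover have "(norm (mult_app \<phi> w))\<^sup>2 \<le> (K * norm w)\<^sup>2"
    using le in_dom f0 by (simp add: nn_integral_square[OF sq] mult_app_abs)
  ultimately have "norm (mult_app \<phi> w) \<le> K * norm w"
    using power2_le_imp_le by blast
  with in_dom show ?thesis ..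
qed

section \<open>Sobolev spaces are closed under subtraction\<close>

text \<open>
  The characters have modulus 1 and the torus has finite measure. This makes the integrals that
  define Fourier coefficients converge, hence makes the coefficients additive.
\<close>

lemma square_integrable_character:
  "square_integrable (\<lambda>x::real ^ 'd. cis (- (\<Sum>i\<in>UNIV. of_int (k $ i) * x $ i)))"
proof -
  have "torus \<subseteq> cbox 0 (\<chi> i. 2 * pi :: real ^ 'd)"
    by (auto simp: torus_def mem_box_cart less_imp_le)
  then have "emeasure lborel (torus :: (real ^ 'd) set) < \<infinity>"
    by (meson bounded_cbox bounded_subset emeasure_bounded_finite)
  moreover have "torus \<inter> space lborel \<in> sets (lborel :: (real ^ 'd) measure)"
  proof -
    have "(torus :: (real ^ 'd) set) = (\<Inter>i. {x. 0 \<le> x $ i} \<inter> {x. x $ i < 2 * pi})"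
      by (auto simp: torus_def)
    also have "\<dots> \<in> sets borel"
      by (intro sets.countable_INT'' sets.Int borel_closed borel_open
        closed_Collect_le open_Collect_less continuous_intros)  auto
    finally show ?thesis by simp
  qed
  ultimately have "finite_measure (torus_measure :: (real ^ 'd) measure)"
    unfolding torus_measure_def
    by (intro finite_measureI) (simp add: emeasure_restrict_space space_restrict_space)
  then have "integrable (torus_measure :: (real ^ 'd) measure) (\<lambda>x. 1 :: real)"
    by (simp add: finite_measure.integrable_const)
  then show ?thesis
    by (simp add: square_integrable_def measurable_character)
qed

lemma fourier_coeff_diff: "fourier_coeff (v - w) k = fourier_coeff v k - fourier_coeff w k"
proof -
  have int: "integrable torus_measure (\<lambda>x. f x * cis (- (\<Sum>i\<in>UNIV. of_int (k $ i) * x $ i)))"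
    if "square_integrable f" for f :: "real ^ 'a \<Rightarrow> complex" and k
    using square_integrable_mult_cnj[OF that square_integrable_cnj[OF square_integrable_character[of k]]]
    by (simp only: complex_cnj_cnj)
  show ?thesis
    by transfer (simp add: int left_diff_distrib diff_divide_distrib)
qed

text \<open>
  The Frechet inequality is postulated for perturbations in \<open>sobolev 2\<close>; the perturbation to which it
  is applied is the difference of an iterate and the exact solution.
\<close>

lemma sobolev_diff:
  assumes "v \<in> sobolev s" "w \<in> sobolev s"
  shows "v - w \<in> sobolev s"
proof -
  let ?m = "\<lambda>k :: int ^ 'a. (1 + (\<Sum>i\<in>UNIV. (of_int (k $ i))\<^sup>2)) ^ s :: real"
  let ?c = "\<lambda>f k. (cmod (fourier_coeff f k))\<^sup>2"
  have m: "0 \<le> ?m k" for k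
    by (simp add: sum_nonneg)
  have "(\<lambda>k. 2 * (?m k * ?c v k) + 2 * (?m k * ?c w k)) summable_on UNIV"
    using assms by (intro summable_on_add summable_on_cmult_right) (auto simp: sobolev_def)
  then have "(\<lambda>k. ?m k * ?c (v - w) k) summable_on UNIV"
  proof (rule summable_on_comparison_test)
    fix k
    have "(cmod (a - b))\<^sup>2 \<le> 2 * (cmod a)\<^sup>2 + 2 * (cmod b)\<^sup>2" for a b
    proof -
      have "(cmod (a - b))\<^sup>2 \<le> (cmod a + cmod b)\<^sup>2"
        by (intro power_mono norm_triangle_ineq4) auto
      also have "\<dots> \<le> 2 * (cmod a)\<^sup>2 + 2 * (cmod b)\<^sup>2"
        using sum_squares_bound[of "cmod a" "cmod b"] by (simp add: power2_sum)
      finally show ?thesis .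
    qed
    then have "?m k * ?c (v - w) k \<le> ?m k * (2 * ?c v k + 2 * ?c w k)"
      unfolding fourier_coeff_diff using m by (rule mult_left_mono)
    then show "?m k * ?c (v - w) k \<le> 2 * (?m k * ?c v k) + 2 * (?m k * ?c w k)"
      by (simp add: algebra_simps)
  qed (use m in auto)
  then show ?thesis
    by (simp add: sobolev_def)
qed

section \<open>Perturbation of the multiplicative part of a generator\<close>

text \<open>
  On the common domain the difference of the two operators is multiplication by \<open>\<phi> - \<psi>\<close>. It
  extends boundedly to \<open>w\<close>, and writing \<open>\<phi> = (\<phi> - \<psi>) + \<psi>\<close> then shows that \<open>\<phi> w\<close> is
  square-integrable, so that the domain does not shrink when \<open>\<psi>\<close> is replaced by \<open>\<phi>\<close>.
\<close>

lemma perturbed_operator_domain: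
  assumes lin: "linear_op (op_add L (mult_op \<phi>))" "linear_op (op_add L (mult_op \<psi>))"
    and norm: "op_norm (op_diff (op_add L (mult_op \<phi>)) (op_add L (mult_op \<psi>))) \<le> ennreal K"
    and "0 \<le> K"
    and w: "w \<in> op_dom (op_add L (mult_op \<psi>))"
  shows "w \<in> op_dom (op_add L (mult_op \<phi>))"
    and "norm (op_app (op_add L (mult_op \<phi>)) w - op_app (op_add L (mult_op \<psi>)) w) \<le> K * norm w"
proof -
  let ?A = "op_diff (op_add L (mult_op \<phi>)) (op_add L (mult_op \<psi>))"
  let ?\<chi> = "\<lambda>x. \<phi> x - \<psi> x"
  note bound = op_norm_le_imp_bound[OF linear_op_op_diff[OF lin] norm \<open>0 \<le> K\<close>]
  have A: "in_mult_dom ?\<chi> v \<and> mult_app ?\<chi> v = op_app ?A v" if "v \<in> op_dom ?A" for v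
    using that mult_diff[of \<phi> v \<psi>] by (auto simp: op_diff_def op_add_def mult_op_def)
  have "in_mult_dom ?\<chi> w \<and> norm (mult_app ?\<chi> w) \<le> K * norm w"
    using bound A by (intro bounded_multiplication_extends[of "op_dom ?A"]) auto
  moreover from this have "in_mult_dom \<phi> w \<and> mult_app \<phi> w = mult_app ?\<chi> w + mult_app \<psi> w"
    using w mult_add[of ?\<chi> w \<psi>] by (simp add: op_add_def mult_op_def)
  ultimately show "w \<in> op_dom (op_add L (mult_op \<phi>))"
    and "norm (op_app (op_add L (mult_op \<phi>)) w - op_app (op_add L (mult_op \<psi>)) w) \<le> K * norm w"
    using w by (auto simp: op_add_def mult_op_def)
qed

section \<open>Energy estimates for solutions\<close>

lemma solution_norm_le:
  assumes sol: "solves_on {a..b} A w"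
    and sa: "\<And>t. t \<in> {a..b} \<Longrightarrow> self_adjoint (A t)"
    and t: "t \<in> {a..b}"
  shows "norm (w t) \<le> norm (w a)"
proof -
  let ?w' = "\<lambda>t. scaleC (- \<i>) (op_app (A t) (w t))"
  have "norm (w t) \<le> norm (w a) + 0 * (t - a)"
  proof (rule norm_growth_bound[where e' = ?w' and b = b])
    fix t assume t: "t \<in> {a..b}"
    obtain w' where "(w has_vector_derivative w') (at t within {a..b})"
        "scaleC \<i> w' = op_app (A t) (w t)" and dom: "w t \<in> op_dom (A t)"
      using sol t unfolding solves_on_def by blast
    then show "(w has_vector_derivative ?w' t) (at t within {a..b})"
      using solution_velocity by metis
    show "inner (?w' t) (w t) \<le> 0 * norm (w t)"
      using self_adjoint_Im_cinner[OF sa[OF t] dom] by (simp add: inner_solution_velocity)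
  qed (use t in auto)
  then show ?thesis by simp
qed

text \<open>
  In the iteration \<open>w\<close> is the new iterate and \<open>v\<close> the exact solution. The difference of their
  equations is split as \<open>A w - B v = A (w - v) + (A v - B v)\<close>; the term \<open>A (w - v)\<close> does not
  contribute to the energy, and the defect is paired with \<open>w - v\<close>.
\<close>

lemma solution_difference_le:
  assumes sol: "solves_on {a..b} A w" "solves_on {a..b} B v" and init: "w a = v a"
    and sa: "\<And>t. t \<in> {a..b} \<Longrightarrow> self_adjoint (A t)"
    and dom: "\<And>t. t \<in> {a..b} \<Longrightarrow> v t \<in> op_dom (A t)"
    and defect: "\<And>t. t \<in> {a..b} \<Longrightarrow> norm (op_app (A t) (v t) - op_app (B t) (v t)) \<le> M"
    and t: "t \<in> {a..b}"
  shows "norm (w t - v t) \<le> M * (t - a)"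
proof -
  let ?e = "\<lambda>t. w t - v t"
  let ?R = "\<lambda>t. op_app (A t) (v t) - op_app (B t) (v t)"
  let ?e' = "\<lambda>t. scaleC (- \<i>) (op_app (A t) (?e t) + ?R t)"
  have "norm (?e t) \<le> norm (?e a) + M * (t - a)"
  proof (rule norm_growth_bound[where e' = ?e' and b = b])
    fix t assume t: "t \<in> {a..b}"
    obtain w' v' where d: "(w has_vector_derivative w') (at t within {a..b})"
        "(v has_vector_derivative v') (at t within {a..b})"
      and eq: "scaleC \<i> w' = op_app (A t) (w t)" "scaleC \<i> v' = op_app (B t) (v t)"
      and wd: "w t \<in> op_dom (A t)"
      using sol t unfolding solves_on_def by blast
    have lin: "?e t \<in> op_dom (A t) \<and> op_app (A t) (?e t) = op_app (A t) (w t) - op_app (A t) (v t)"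
      using sa[OF t] wd dom[OF t] by (intro linear_op_diff) (auto simp: self_adjoint_def)
    have "scaleC \<i> (w' - v') = op_app (A t) (?e t) + ?R t"
      using eq lin by (simp add: scaleC_diff)
    then show "(?e has_vector_derivative ?e' t) (at t within {a..b})"
      using has_vector_derivative_diff[OF d] solution_velocity by fastforce
    have "inner (?e' t) (?e t) = Im (cinner (?R t) (?e t))"
      using self_adjoint_Im_cinner[OF sa[OF t] conjunct1[OF lin]]
      by (simp only: inner_solution_velocity cinner_add_left plus_complex.sel)
    also have "\<dots> \<le> norm (?R t) * norm (?e t)"
      by (rule Im_cinner_le)
    also have "\<dots> \<le> M * norm (?e t)"
      using defect[OF t] by (intro mult_right_mono) auto
    finally show "inner (?e' t) (?e t) \<le> M * norm (?e t)" .
  next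
    show "0 \<le> M"
      using defect[OF t] norm_ge_zero order_trans by blast
  qed (rule t)
  then show ?thesis
    using init by simp
qed

section \<open>Convergence of the iteration\<close>

theorem theorem2:
  fixes L :: "'d::finite L2_operator"
    and g :: "'d torus_L2 \<Rightarrow> 'd torus_L2 \<Rightarrow> real ^ 'd \<Rightarrow> complex"
    and G :: "'d torus_L2 \<Rightarrow> 'd L2_operator"
    and s :: nat
    and t\<^sub>n t\<^sub>n\<^sub>1 h C c\<^sub>1 p\<^sub>1 :: real
    and r :: "real \<Rightarrow> real"
    and u :: "real \<Rightarrow> 'd torus_L2"
    and U :: "nat \<Rightarrow> real \<Rightarrow> 'd torus_L2"
    and \<rho> :: "nat \<Rightarrow> real \<Rightarrow> real"
  assumes "self_adjoint L"
    and "\<And>v. v \<in> sobolev s \<Longrightarrow> AE x in torus_measure. g v (conj_L2 v) x \<in> \<real>"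
    and "\<And>v. G v = op_add L (mult_op (g v (conj_L2 v)))"
    and "\<And>v. v \<in> sobolev s \<Longrightarrow> self_adjoint (G v)"
    and "t\<^sub>n < t\<^sub>n\<^sub>1" and "h = t\<^sub>n\<^sub>1 - t\<^sub>n"
    and "solves_on {t\<^sub>n..t\<^sub>n\<^sub>1} (\<lambda>t. G (u t)) u"
    and "\<And>t. t \<in> {t\<^sub>n..t\<^sub>n\<^sub>1} \<Longrightarrow> U 0 t = u t\<^sub>n"
    and "\<And>k. solves_on {t\<^sub>n..t\<^sub>n\<^sub>1} (\<lambda>t. G (U k t)) (U (Suc k))"
    and "\<And>k. U (Suc k) t\<^sub>n = u t\<^sub>n"
    and "\<And>t. t \<in> {t\<^sub>n..t\<^sub>n\<^sub>1} \<Longrightarrow> u t \<in> sobolev s \<inter> sobolev 2"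
    and "\<And>k t. t \<in> {t\<^sub>n..t\<^sub>n\<^sub>1} \<Longrightarrow> U k t \<in> sobolev s \<inter> sobolev 2"
    and "\<And>k t. \<rho> k t = norm (U k t - u t)"
    and "0 < C"
    and "\<And>t. t \<in> {t\<^sub>n..t\<^sub>n\<^sub>1} \<Longrightarrow> 0 < r t \<and> frechet_constant G (u t) C (r t)"
    and "\<And>k t. 1 \<le> k \<Longrightarrow> t \<in> {t\<^sub>n..t\<^sub>n\<^sub>1} \<Longrightarrow> norm (U k t - u t) < r t"
    and "0 < c\<^sub>1"
    and "\<And>t. t \<in> {t\<^sub>n..t\<^sub>n\<^sub>1} \<Longrightarrow> \<rho> 1 t \<le> c\<^sub>1 * h powr (p\<^sub>1 + 1)"
  shows "(\<forall>k\<ge>1. \<forall>t\<in>{t\<^sub>n..t\<^sub>n\<^sub>1}.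
            \<rho> k t \<le> (C * norm (u t\<^sub>n)) ^ (k - 1) * c\<^sub>1 * h powr (p\<^sub>1 + real k)) \<and>
         (ereal h < inverse (ereal (C * norm (u t\<^sub>n))) \<longrightarrow>
            (\<forall>t\<in>{t\<^sub>n..t\<^sub>n\<^sub>1}. (\<lambda>k. \<rho> k t) \<longlonglongrightarrow> 0))"
proof -
  let ?J = "{t\<^sub>n..t\<^sub>n\<^sub>1}" and ?N = "norm (u t\<^sub>n)"
  note G = assms(3) and sa = assms(4) and h = assms(5,6) and sol_u = assms(7) and sol_U = assms(9)
    and u_reg = assms(11) and U_reg = assms(12) and \<rho> = assms(13) and C = assms(14)
  have h_pos: "0 < h"
    using h by simp
  have u_le: "norm (u t) \<le> ?N" if "t \<in> ?J" for t
    using solution_norm_le[OF sol_u _ that] sa u_reg by blast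
  \<comment> \<open>One iteration multiplies a uniform error bound by \<open>C * norm (u t\<^sub>n) * h\<close>. The initial iterate is excluded because it need not be in the
    range where the Frechet inequality holds.\<close>
  have step: "\<rho> (Suc k) t \<le> C * B * ?N * h"
    if k: "1 \<le> k" and B: "\<And>t. t \<in> ?J \<Longrightarrow> \<rho> k t \<le> B" and t: "t \<in> ?J" for k B t
  proof -
    have pert: "u t \<in> op_dom (G (U k t)) \<and>
        norm (op_app (G (U k t)) (u t) - op_app (G (u t)) (u t)) \<le> C * B * ?N" if t: "t \<in> ?J" for t
    proof -
      let ?K = "C * norm (U k t - u t)"
      have "U k t - u t \<in> sobolev 2"
        using u_reg[OF t] U_reg[OF t] by (auto intro: sobolev_diff)
      then have "op_norm (op_diff (G (u t + (U k t - u t))) (G (u t))) \<le> ennreal ?K"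
        using assms(15)[OF t] assms(16)[OF k t] unfolding frechet_constant_def by blast
      then have norm: "op_norm (op_diff (G (U k t)) (G (u t))) \<le> ennreal ?K"
        by simp
      have lin: "linear_op (G (U k t))" "linear_op (G (u t))"
        using sa u_reg[OF t] U_reg[OF t] unfolding self_adjoint_def by blast+
      have dom: "u t \<in> op_dom (G (u t))"
        using sol_u t by (auto simp: solves_on_def)
      have K: "0 \<le> ?K"
        using C by simp
      note P = perturbed_operator_domain[OF lin[unfolded G] norm[unfolded G] K dom[unfolded G],
          folded G]
      have "?K * norm (u t) \<le> C * B * ?N"
        using u_le[OF t] B[OF t] C order_trans[OF norm_ge_zero B[OF t, unfolded \<rho>]] unfolding \<rho>
        by (intro mult_mono mult_left_mono) auto
      then show ?thesis
        using P by (meson order_trans)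
    qed
    have "\<rho> (Suc k) t \<le> C * B * ?N * (t - t\<^sub>n)"
      unfolding \<rho>
      by (rule solution_difference_le[OF sol_U sol_u])
        (use pert assms(10) sa U_reg t in auto)
    also have "\<dots> \<le> C * B * ?N * h"
    proof -
      have "0 \<le> B"
        using B[OF t] unfolding \<rho> by (rule order_trans[OF norm_ge_zero])
      then show ?thesis
        using C t h by (intro mult_left_mono) auto
    qed
    finally show ?thesis .
  qed
  have bound: "\<rho> (Suc k) t \<le> (C * ?N) ^ k * c\<^sub>1 * h powr (p\<^sub>1 + real (Suc k))" if "t \<in> ?J" for k t
    using that
  proof (induction k arbitrary: t)
    case 0
    then show ?case using assms(18) by simp
  next
    case (Suc k)
    have "\<rho> (Suc (Suc k)) t \<le> C * ((C * ?N) ^ k * c\<^sub>1 * h powr (p\<^sub>1 + real (Suc k))) * ?N * h"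
      using Suc by (intro step) auto
    also have "h powr (p\<^sub>1 + real (Suc (Suc k))) = h powr (p\<^sub>1 + real (Suc k)) * h"
      using powr_add[of h "p\<^sub>1 + real (Suc k)" 1] h_pos by (simp add: add_ac)
    then have "C * ((C * ?N) ^ k * c\<^sub>1 * h powr (p\<^sub>1 + real (Suc k))) * ?N * h =
        (C * ?N) ^ Suc k * c\<^sub>1 * h powr (p\<^sub>1 + real (Suc (Suc k)))"
      by simp
    finally show ?case .
  qed
  have "(\<lambda>k. \<rho> k t) \<longlonglongrightarrow> 0" if small: "ereal h < inverse (ereal (C * ?N))" and t: "t \<in> ?J" for t
  proof -
    define q where "q = C * ?N * h"
    have "0 \<le> q" "q < 1"
    proof -
      show "0 \<le> q" using C h_pos by (simp add: q_def)
      show "q < 1"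
      \<comment> \<open>If the initial value is 0, the bound on \<open>h\<close> is infinite and the ratio is 0.\<close>
      proof (cases "C * ?N = 0")
        case False
        then have "0 < C * ?N" using C by (simp add: zero_less_mult_iff)
        then have "h < inverse (C * ?N)" using small False by auto
        then have "h * (C * ?N) < 1"
          using \<open>0 < C * ?N\<close> by (simp only: inverse_eq_divide pos_less_divide_eq)
        then show ?thesis by (simp add: q_def mult.commute)
      qed (auto simp: q_def)
    qed
    have geometric: "norm (\<rho> (Suc k) t) \<le> c\<^sub>1 * h powr (p\<^sub>1 + 1) * q ^ k" for k
    proof -
      have "h powr (p\<^sub>1 + real (Suc k)) = h powr (p\<^sub>1 + 1) * h ^ k"
        using h_pos by (simp add: powr_add powr_realpow algebra_simps)
      then show ?thesis
        using bound[OF t, of k] \<rho>[of "Suc k" t]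
        by (simp add: q_def power_mult_distrib mult_ac)
    qed
    have "(\<lambda>k. c\<^sub>1 * h powr (p\<^sub>1 + 1) * q ^ k) \<longlonglongrightarrow> 0"
      using \<open>0 \<le> q\<close> \<open>q < 1\<close> by (intro tendsto_mult_right_zero LIMSEQ_realpow_zero)
    then have "(\<lambda>k. \<rho> (Suc k) t) \<longlonglongrightarrow> 0"
      by (rule Lim_null_comparison[OF always_eventually[OF allI[OF geometric]]])
    then show ?thesis
      by (rule LIMSEQ_imp_Suc)
  qed
  moreover have "\<rho> k t \<le> (C * ?N) ^ (k - 1) * c\<^sub>1 * h powr (p\<^sub>1 + real k)"
    if "1 \<le> k" "t \<in> ?J" for k t
    using bound[OF that(2), of "k - 1"] that(1) by simp
  ultimately show ?thesis
    by blast
qed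

end
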